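(* Let $A\in\mathbb{R}^{q\times n}$ with rows $A_1,\dots,A_q$ and $b\in\mathbb{R}^q$. For $x\in\mathbb{R}^n$ and symmetric $X\in\mathbb{R}^{n\times n}$ with $Ax=b$ and $\begin{bmatrix}1 & x^\top \\ x & X\end{bmatrix}\succeq0$, the following two constraint sets are equivalent: $$\text{(I)}\quad A^\top A\cdot X-2b^\top Ax+b^\top b=0;$$ $$\text{(II)}\quad \sum_{k=1}^nA_{ik}X_{jk}=x_jb_i\quad\forall j\in\{1,\dots,n\},\ i\in\{1,\dots,q\}.$$ Consequently, in the $0$-$1$ case: let $(QP_{I})$ and $(QP_{II})$ be the two versions of a $0$-$1$ quadratic program with linear constraints $Ax=b$ (as in the context) whose redundant constraints are, respectively, the single constraint $A^\top A\cdot xx^\top-2b^\top Ax+b^\top b=0$ and the constraints $x_jA_ix=x_jb_i$ ($j\in\{1,\dots,n\}$, $i\in\{1,\dots,q\}$). Then the best convexifications of the total and partial Lagrangians have the same value for both, namely the SDP bound: $$TL^{x}_{I}=TL^{x}_{II}=PL^{X}_{I}=PL^{X}_{II}=S_{I}=S_{II}.$$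
   Context: Notation: $M\cdot N=\sum_{i,j}M_{ij}N_{ij}$; $M\succeq0$ means symmetric positive semidefinite; infima/suprema are taken in $[-\infty,+\infty]$, with $\inf\emptyset=+\infty$, $\sup\emptyset=-\infty$. General program: data are symmetric $Q,B_1,\dots,B_p,\overline B_1,\dots,\overline B_{\bar p}\in\mathbb{R}^{n\times n}$; $c,d_i,\bar d_j\in\mathbb{R}^n$; $e\in\mathbb{R}^p$, $\bar e\in\mathbb{R}^{\bar p}$; $A\in\mathbb{R}^{q\times n}$, $b\in\mathbb{R}^q$: $$\min_{x\in\mathbb{R}^n}\ Q\cdot xx^\top+c^\top x\ \text{ s.t. } Ax=b;\ \overline B_j\cdot xx^\top+\bar d_j^\top x=\bar e_j\ (1\le j\le\bar p);\ B_i\cdot xx^\top+d_i^\top x=e_i\ \text{or}\le e_i\ (1\le i\le p).$$ The constraints with bars are redundant (implied by $Ax=b$); in $(QP_I)$ and $(QP_{II})$ they are the ones given in the claim, written with symmetric matrices, and all the other data are identical. "$0$-$1$ case" means $p\ge n$ and for $i\le n$ the $i$-th unbarred quadratic constraint is the equality $x_i^2=x_i$. For such a program: the SDP relaxation value is $S=\inf\{Q\cdot X+c^\top x:\ Ax=b;\ \overline B_j\cdot X+\bar d_j^\top x=\bar e_j\ \forall j;\ B_i\cdot X+d_i^\top x=e_i\ (\text{resp. }\le e_i)\ \forall i;\ \begin{bmatrix}1 & x^\top \\ x & X\end{bmatrix}\succeq0\}$. With $\mathcal M=\{\mu\in\mathbb{R}^p:\mu_i\ge0\text{ whenever constraint }i\text{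 is an inequality}\}$, $Q_{\mu,\nu}=Q+\sum_i\mu_iB_i+\sum_j\nu_j\overline B_j$, $c_{\mu,\nu}=c+\sum_i\mu_id_i+\sum_j\nu_j\bar d_j$, $\kappa_{\mu,\nu}=\mu^\top e+\nu^\top\bar e$, the total Lagrangian value is $$TL^{x}=\sup_{\mu\in\mathcal M,\ \nu\in\mathbb{R}^{\bar p},\ \beta\in\mathbb{R}^q}\ \inf_{x\in\mathbb{R}^n}\{Q_{\mu,\nu}\cdot xx^\top+(c_{\mu,\nu}+A^\top\beta)^\top x-\kappa_{\mu,\nu}-\beta^\top b\}$$ and the (SDP) partial Lagrangian value is $$PL^{X}=\sup_{\mu\in\mathcal M,\ \nu\in\mathbb{R}^{\bar p}}\ \inf\Big\{Q_{\mu,\nu}\cdot X+c_{\mu,\nu}^\top x-\kappa_{\mu,\nu}:\ Ax=b,\ \begin{bmatrix}1 & x^\top \\ x & X\end{bmatrix}\succeq0\Big\}.$$ Subscripts $I$, $II$ indicate the values for $(QP_I)$, $(QP_{II})$. *)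

theory Defs
  imports "HOL-Analysis.Analysis"
begin

text \<open>Throughout, \<open>M \<bullet> N\<close> on \<open>real^'n^'n\<close> is the library inner product, that is,
  the sum of \<open>M $ i $ j * N $ i $ j\<close> over all \<open>i\<close> and \<open>j\<close>; cf. \<open>matrix_inner\<close> below.\<close>

lemma matrix_inner:
  fixes M N :: "real^'n^'n"
  shows "M \<bullet> N = (\<Sum>i\<in>UNIV. \<Sum>j\<in>UNIV. M $ i $ j * N $ i $ j)"
  by (simp add: inner_vec_def)

definition outer :: "real^'n \<Rightarrow> real^'n \<Rightarrow> real^'n^'n" where
  "outer u v = (\<chi> i j. u $ i * v $ j)"

definition symmetric :: "real^'n^'n \<Rightarrow> bool" where
  "symmetric M \<longleftrightarrow> transpose M = M"

definition psd :: "real^'n^'n \<Rightarrow> bool" where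
  "psd M \<longleftrightarrow> symmetric M \<and> (\<forall>v. 0 \<le> v \<bullet> (M *v v))"

text \<open>The block matrix with blocks \<open>1\<close>, the transpose of \<open>x\<close>, \<open>x\<close> and \<open>X\<close>;
  the index \<open>None\<close> is the additional row and column.\<close>

definition bordered :: "real^'n \<Rightarrow> real^'n^'n \<Rightarrow> real^('n option)^('n option)" where
  "bordered x X = (\<chi> r s.
     case r of
       None \<Rightarrow> (case s of None \<Rightarrow> 1 | Some j \<Rightarrow> x $ j)
     | Some i \<Rightarrow> (case s of None \<Rightarrow> x $ i | Some j \<Rightarrow> X $ i $ j))"

text \<open>A family, indexed by \<open>'k\<close>, of data of quadratic constraints
  \<open>qmat k \<bullet> outer x x + qlin k \<bullet> x = qrhs $ k\<close> (or \<open>\<le>\<close>).\<close>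

record ('n::finite, 'k::finite) qcons =
  qmat :: "'k \<Rightarrow> real^'n^'n"
  qlin :: "'k \<Rightarrow> real^'n"
  qrhs :: "real^'k"

text \<open>A quadratic program without its redundant constraints, which form a separate family
  \<open>('n, 'r) qcons\<close>. The constraints \<open>cons\<close> with index in \<open>ineqs\<close> are inequalities \<open>\<le>\<close>,
  the others are equations.\<close>

record ('n::finite, 'p::finite, 'q::finite) qprog =
  obj_mat :: "real^'n^'n"
  obj_vec :: "real^'n"
  cons :: "('n, 'p) qcons"
  ineqs :: "'p set"
  lin_mat :: "real^'n^'q"
  lin_rhs :: "real^'q"

definition symmetric_data :: "('n::finite, 'p::finite, 'q::finite) qprog \<Rightarrow> bool" where
  "symmetric_data P \<longleftrightarrow>
     symmetric (obj_mat P) \<and> (\<forall>i. symmetric (qmat (cons P) i))"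

text \<open>The coordinates are matched by an injection \<open>\<iota>\<close> with the constraints
  \<open>(x $ i)\<^sup>2 = x $ i\<close>; numbering these constraints first gives \<open>CARD('p) \<ge> CARD('n)\<close> and
  \<open>\<iota> i = i\<close>.\<close>

definition zero_one :: "('n::finite, 'p::finite, 'q::finite) qprog \<Rightarrow> bool" where
  "zero_one P \<longleftrightarrow> (\<exists>\<iota> :: 'n \<Rightarrow> 'p. inj \<iota> \<and>
     (\<forall>i. \<iota> i \<notin> ineqs P \<and>
          qmat (cons P) (\<iota> i) = outer (axis i 1) (axis i 1) \<and>
          qlin (cons P) (\<iota> i) = - axis i 1 \<and>
          qrhs (cons P) $ \<iota> i = 0))"

definition sdp_feasible ::
  "('n::finite, 'p::finite, 'q::finite) qprog \<Rightarrow> ('n, 'r::finite) qcons \<Rightarrow>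
   ((real^'n) \<times> (real^'n^'n)) set" where
  "sdp_feasible P R = {(x, X).
     lin_mat P *v x = lin_rhs P \<and>
     (\<forall>j. qmat R j \<bullet> X + qlin R j \<bullet> x = qrhs R $ j) \<and>
     (\<forall>i. if i \<in> ineqs P
          then qmat (cons P) i \<bullet> X + qlin (cons P) i \<bullet> x \<le> qrhs (cons P) $ i
          else qmat (cons P) i \<bullet> X + qlin (cons P) i \<bullet> x = qrhs (cons P) $ i) \<and>
     psd (bordered x X)}"

definition sdp_value ::
  "('n::finite, 'p::finite, 'q::finite) qprog \<Rightarrow> ('n, 'r::finite) qcons \<Rightarrow> ereal" where
  "sdp_value P R =
     (INF (x, X) \<in> sdp_feasible P R. ereal (obj_mat P \<bullet> X + obj_vec P \<bullet> x))"

definition multipliers :: "('n::finite, 'p::finite, 'q::finite) qprog \<Rightarrow> (real^'p) set" where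
  "multipliers P = {\<mu>. \<forall>i\<in>ineqs P. 0 \<le> \<mu> $ i}"

definition lag_mat ::
  "('n::finite, 'p::finite, 'q::finite) qprog \<Rightarrow> ('n, 'r::finite) qcons \<Rightarrow>
   real^'p \<Rightarrow> real^'r \<Rightarrow> real^'n^'n" where
  "lag_mat P R \<mu> \<nu> = obj_mat P + (\<Sum>i\<in>UNIV. \<mu> $ i *\<^sub>R qmat (cons P) i)
                               + (\<Sum>j\<in>UNIV. \<nu> $ j *\<^sub>R qmat R j)"

definition lag_vec ::
  "('n::finite, 'p::finite, 'q::finite) qprog \<Rightarrow> ('n, 'r::finite) qcons \<Rightarrow>
   real^'p \<Rightarrow> real^'r \<Rightarrow> real^'n" where
  "lag_vec P R \<mu> \<nu> = obj_vec P + (\<Sum>i\<in>UNIV. \<mu> $ i *\<^sub>R qlin (cons P) i)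
                               + (\<Sum>j\<in>UNIV. \<nu> $ j *\<^sub>R qlin R j)"

definition lag_const ::
  "('n::finite, 'p::finite, 'q::finite) qprog \<Rightarrow> ('n, 'r::finite) qcons \<Rightarrow>
   real^'p \<Rightarrow> real^'r \<Rightarrow> real" where
  "lag_const P R \<mu> \<nu> = \<mu> \<bullet> qrhs (cons P) + \<nu> \<bullet> qrhs R"

definition total_lagrangian_value ::
  "('n::finite, 'p::finite, 'q::finite) qprog \<Rightarrow> ('n, 'r::finite) qcons \<Rightarrow> ereal" where
  "total_lagrangian_value P R =
     (SUP (\<mu>, \<nu>, \<beta>) \<in> multipliers P \<times> UNIV \<times> UNIV. INF x.
        ereal (lag_mat P R \<mu> \<nu> \<bullet> outer x x
               + (lag_vec P R \<mu> \<nu> + transpose (lin_mat P) *v \<beta>) \<bullet> x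
               - lag_const P R \<mu> \<nu> - \<beta> \<bullet> lin_rhs P))"

definition partial_lagrangian_value ::
  "('n::finite, 'p::finite, 'q::finite) qprog \<Rightarrow> ('n, 'r::finite) qcons \<Rightarrow> ereal" where
  "partial_lagrangian_value P R =
     (SUP (\<mu>, \<nu>) \<in> multipliers P \<times> UNIV.
        INF (x, X) \<in> {(x, X). lin_mat P *v x = lin_rhs P \<and> psd (bordered x X)}.
          ereal (lag_mat P R \<mu> \<nu> \<bullet> X + lag_vec P R \<mu> \<nu> \<bullet> x - lag_const P R \<mu> \<nu>))"

definition redundant_I :: "real^'n^'q \<Rightarrow> real^'q \<Rightarrow> ('n, unit) qcons" where
  "redundant_I A b =
     \<lparr>qmat = (\<lambda>_. transpose A ** A),
      qlin = (\<lambda>_. - 2 *\<^sub>R (transpose A *v b)),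
      qrhs = (\<chi> _. - (b \<bullet> b))\<rparr>"

definition redundant_II :: "real^'n^'q \<Rightarrow> real^'q \<Rightarrow> ('n, 'n \<times> 'q) qcons" where
  "redundant_II A b =
     \<lparr>qmat = (\<lambda>(j, i). (1/2) *\<^sub>R (outer (axis j 1) (A $ i) + outer (A $ i) (axis j 1))),
      qlin = (\<lambda>(j, i). - (b $ i) *\<^sub>R axis j 1),
      qrhs = 0\<rparr>"

text \<open>The two families are symmetric and encode the intended quadratic equations.\<close>

lemma outer_inner: "outer u v \<bullet> outer x y = (u \<bullet> x) * (v \<bullet> y)"
  by (simp add: outer_def inner_vec_def sum_product mult_ac)

lemma symmetric_redundant_I: "symmetric (qmat (redundant_I A b) k)"
  by (simp add: redundant_I_def symmetric_def matrix_transpose_mul)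

lemma symmetric_redundant_II: "symmetric (qmat (redundant_II A b) k)"
  by (cases k) (simp add: redundant_II_def symmetric_def outer_def transpose_def vec_eq_iff mult_ac)

lemma redundant_I_iff:
  "qmat (redundant_I A b) k \<bullet> X + qlin (redundant_I A b) k \<bullet> x = qrhs (redundant_I A b) $ k
   \<longleftrightarrow> (transpose A ** A) \<bullet> X - 2 * (b \<bullet> (A *v x)) + b \<bullet> b = 0"
proof -
  have "(transpose A *v b) \<bullet> x = b \<bullet> (A *v x)"
    by (metis dot_lmul_matrix vector_transpose_matrix transpose_transpose)
  then show ?thesis
    by (simp add: redundant_I_def) linarith
qed

lemma redundant_II_iff:
  "qmat (redundant_II A b) (j, i) \<bullet> outer x x + qlin (redundant_II A b) (j, i) \<bullet> x
     = qrhs (redundant_II A b) $ (j, i)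
   \<longleftrightarrow> x $ j * (A $ i \<bullet> x) = x $ j * b $ i"
  by (simp add: redundant_II_def inner_add_left outer_inner inner_axis' mult_ac)

end

theory Submission
  imports Defs
begin

text \<open>Weak duality gives \<open>TL \<le> PL \<le> S\<close> for each family of redundant constraints, and
  \<open>S\<^sub>I = S\<^bsub>II\<^esub>\<close> because the lifted families are equivalent on the feasible set. For the
  converse \<open>S \<le> TL\<close>, the constraints \<open>X\<^sub>i\<^sub>i = x\<^sub>i\<close> leave the homogenised relaxation without
  nonzero recession directions. Hence, for \<open>r < S\<close>, the constraint residuals over a compact base
  of the semidefinite cone miss the closed cone of admissible residuals, and a strictly
  separating hyperplane provides multipliers whose Lagrangian is bounded below by \<open>r\<close>.\<close>

section \<open>Quadratic polynomials and positive semidefinite matrices\<close>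

lemma quadratic_nonneg_leading:
  fixes a b c :: real
  assumes "\<And>s. 0 \<le> a + s * b + s\<^sup>2 * c"
  shows "0 \<le> c"
proof (rule ccontr)
  assume "\<not> 0 \<le> c"
  then have c: "c < 0" by simp
  have a: "0 \<le> a" using assms[of 0] by simp
  \<comment> \<open>At this \<open>s\<close> the values at \<open>s\<close> and \<open>- s\<close>
    add up to \<open>-2\<close>, since the linear terms cancel.\<close>
  define s where "s = sqrt ((a + 1) / - c)"
  have "s\<^sup>2 * c = - (a + 1)"
    using a c by (simp add: s_def divide_nonneg_neg)
  then show False
    using assms[of s] assms[of "- s"] by simp
qed

lemma quadratic_nonneg_discriminant:
  fixes a b c :: real
  assumes nonneg: "\<And>s. 0 \<le> a + 2 * s * b + s\<^sup>2 * c"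
  shows "b\<^sup>2 \<le> a * c"
proof (cases "c = 0")
  case True
  \<comment> \<open>For \<open>c = 0\<close> and \<open>b \<noteq> 0\<close> the chosen point gives
    the value \<open>-1\<close>.\<close>
  have "b = 0"
    using nonneg[of "- (a + 1) / (2 * b)"] True by (cases "b = 0") (auto simp: field_simps)
  then show ?thesis using True by simp
next
  case False
  have "0 \<le> c"
    using quadratic_nonneg_leading[of a "2 * b" c] nonneg by (simp add: mult_ac)
  with False have c: "0 < c" by simp
  \<comment> \<open>\<open>- b / c\<close> is the minimizer; multiplying the minimum by
    \<open>c\<close> gives the discriminant.\<close>
  have "0 \<le> (a + 2 * (- b / c) * b + (- b / c)\<^sup>2 * c) * c"
    using nonneg[of "- b / c"] c by (intro mult_nonneg_nonneg) auto
  also have "\<dots> = a * c - b\<^sup>2"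
    using c by (simp add: field_simps power2_eq_square)
  finally show ?thesis by simp
qed

lemma inner_outer: "M \<bullet> outer u v = u \<bullet> (M *v v)"
  by (simp add: matrix_inner outer_def inner_vec_def matrix_vector_mult_def sum_distrib_left mult_ac)

lemma outer_mult_vec: "outer u v *v w = (v \<bullet> w) *\<^sub>R u"
  by (simp add: vec_eq_iff outer_def inner_vec_def matrix_vector_mult_def sum_distrib_left
      sum_distrib_right mult_ac)

lemma symmetric_inner_commute:
  assumes "symmetric M"
  shows "u \<bullet> (M *v w) = w \<bullet> (M *v u)"
  using assms by (metis symmetric_def dot_lmul_matrix vector_transpose_matrix inner_commute)

lemma symmetric_outer: "symmetric (outer u u)"
  by (simp add: symmetric_def outer_def transpose_def vec_eq_iff mult_ac)

lemma symmetric_diff: "symmetric M \<Longrightarrow> symmetric N \<Longrightarrow> symmetric (M - N)"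
  by (simp add: symmetric_def transpose_def vec_eq_iff)

lemma symmetric_add: "symmetric M \<Longrightarrow> symmetric N \<Longrightarrow> symmetric (M + N)"
  by (simp add: symmetric_def transpose_def vec_eq_iff)

lemma symmetric_scaleR: "symmetric M \<Longrightarrow> symmetric (k *\<^sub>R M)"
  by (simp add: symmetric_def transpose_def vec_eq_iff)

text \<open>The form of \<open>Y\<close> at \<open>u + s *\<^sub>R w\<close> is a nonnegative
  quadratic in \<open>s\<close>, to which the discriminant condition applies.\<close>

lemma psd_cauchy_schwarz:
  assumes "psd Y"
  shows "(u \<bullet> (Y *v w))\<^sup>2 \<le> (u \<bullet> (Y *v u)) * (w \<bullet> (Y *v w))"
proof (rule quadratic_nonneg_discriminant)
  fix s :: real
  have sym: "w \<bullet> (Y *v u) = u \<bullet> (Y *v w)"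
    using assms symmetric_inner_commute by (auto simp: psd_def)
  have "0 \<le> (u + s *\<^sub>R w) \<bullet> (Y *v (u + s *\<^sub>R w))"
    using assms by (auto simp: psd_def)
  then show "0 \<le> u \<bullet> (Y *v u) + 2 * s * (u \<bullet> (Y *v w)) + s\<^sup>2 * (w \<bullet> (Y *v w))"
    by (simp add: matrix_vector_right_distrib matrix_vector_mult_scaleR inner_add_left
        inner_add_right sym power2_eq_square algebra_simps)
qed

text \<open>Cauchy-Schwarz with \<open>u = Y *v w\<close> bounds the fourth power of the norm of
  \<open>Y *v w\<close> by 0.\<close>

lemma psd_kernel:
  assumes "psd Y" "w \<bullet> (Y *v w) = 0"
  shows "Y *v w = 0"
  using psd_cauchy_schwarz[OF assms(1), of "Y *v w" w] assms(2) by simp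

lemma axis_inner_mult_axis: "axis i 1 \<bullet> (M *v axis j 1) = M $ i $ (j :: 'n::finite)"
  for M :: "real^'n^'m::finite"
  by (simp add: inner_axis' matrix_vector_mult_basis column_def)

text \<open>Cauchy-Schwarz divided by the pivot \<open>w \<bullet> (Y *v w)\<close> says that the
  subtracted rank one form stays below the form of \<open>Y\<close>.\<close>

lemma psd_pivot:
  assumes Y: "psd Y" and pos: "0 < w \<bullet> (Y *v w)"
  shows "psd (Y - (1 / (w \<bullet> (Y *v w))) *\<^sub>R outer (Y *v w) (Y *v w))"
  unfolding psd_def
proof (intro conjI allI)
  let ?p = "w \<bullet> (Y *v w)"
  show "symmetric (Y - (1 / ?p) *\<^sub>R outer (Y *v w) (Y *v w))"
    using Y by (intro symmetric_diff symmetric_scaleR symmetric_outer) (simp add: psd_def)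
  fix v
  have "v \<bullet> ((Y - (1 / ?p) *\<^sub>R outer (Y *v w) (Y *v w)) *v v)
      = v \<bullet> (Y *v v) - (v \<bullet> (Y *v w))\<^sup>2 / ?p"
    by (simp add: matrix_vector_mult_diff_rdistrib scaleR_matrix_vector_assoc[symmetric]
        outer_mult_vec inner_diff_right power2_eq_square inner_commute)
  also have "\<dots> \<ge> 0"
    using psd_cauchy_schwarz[OF Y, of v w] pos by (simp add: divide_le_eq)
  finally show "0 \<le> v \<bullet> ((Y - (1 / ?p) *\<^sub>R outer (Y *v w) (Y *v w)) *v v)" .
qed

text \<open>Gaussian elimination: each pivot splits off a rank one matrix and annihilates a diagonal
  entry, and a positive semidefinite matrix with zero diagonal vanishes.\<close>

lemma inner_psd_nonneg:
  fixes M Y :: "real^'n^'n"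
  assumes M: "\<And>v. 0 \<le> v \<bullet> (M *v v)" and "psd Y"
  shows "0 \<le> M \<bullet> Y"
  using \<open>psd Y\<close>
proof (induction "card {i. Y $ i $ i \<noteq> 0}" arbitrary: Y rule: less_induct)
  case less
  have diag: "0 \<le> Z $ i $ i" if "psd Z" for Z :: "real^'n^'n" and i
    using that axis_inner_mult_axis[of i Z i] unfolding psd_def by metis
  show ?case
  proof (cases "\<forall>i. Y $ i $ i = 0")
    case True
    have "Y *v axis i 1 = 0" for i
      using True by (intro psd_kernel less.prems) (simp add: axis_inner_mult_axis)
    then have "Y $ j $ i = 0" for i j
      using axis_inner_mult_axis[of j Y i] by simp
    then have "Y = 0"
      by (simp add: vec_eq_iff)
    then show ?thesis by simp
  next
    case False
    then obtain i where i: "Y $ i $ i \<noteq> 0" by auto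
    let ?p = "Y $ i $ i" and ?u = "Y *v axis i 1"
    define Y' where "Y' = Y - (1 / ?p) *\<^sub>R outer ?u ?u"
    have p: "0 < ?p" using diag[OF less.prems, of i] i by simp
    have u: "?u $ j = Y $ j $ i" for j
      by (simp add: matrix_vector_mult_basis column_def)
    have psd': "psd Y'"
      using psd_pivot[OF less.prems, of "axis i 1"] p by (simp add: Y'_def axis_inner_mult_axis)
    have Y': "Y' $ j $ j = Y $ j $ j - (Y $ j $ i)\<^sup>2 / ?p" for j
      by (simp add: Y'_def outer_def u power2_eq_square)
    \<comment> \<open>Pivoting only lowers diagonal entries and keeps them nonnegative, so zeros
      persist; entry \<open>i\<close> becomes a new zero and the induction measure drops.\<close>
    have "Y' $ j $ j = 0" if "Y $ j $ j = 0" for j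
    proof -
      have "0 \<le> (Y $ j $ i)\<^sup>2 / ?p" using p by simp
      then show ?thesis using Y'[of j] diag[OF psd', of j] that by linarith
    qed
    moreover have "Y' $ i $ i = 0"
      using p by (simp add: Y' power2_eq_square)
    ultimately have "{j. Y' $ j $ j \<noteq> 0} \<subset> {j. Y $ j $ j \<noteq> 0}"
      using i by blast
    then have "0 \<le> M \<bullet> Y'"
      by (intro less.hyps psd' psubset_card_mono) auto
    moreover have "M \<bullet> Y = M \<bullet> Y' + (1 / ?p) * (?u \<bullet> (M *v ?u))"
      by (simp add: Y'_def inner_diff_right inner_outer)
    moreover have "0 \<le> (1 / ?p) * (?u \<bullet> (M *v ?u))"
      using M p by (intro mult_nonneg_nonneg) auto
    ultimately show ?thesis by linarith
  qed
qed

section \<open>Bordered matrices and the Schur complement\<close>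

lemma sum_option: "(\<Sum>r\<in>UNIV. f r) = f None + (\<Sum>i\<in>UNIV. f (Some i))"
  for f :: "'n::finite option \<Rightarrow> real"
  by (simp add: UNIV_option_conv sum.reindex)

lemma bordered_form:
  "v \<bullet> (bordered x X *v v) =
     (v $ None)\<^sup>2 + 2 * v $ None * ((\<chi> i. v $ Some i) \<bullet> x)
       + (\<chi> i. v $ Some i) \<bullet> (X *v (\<chi> i. v $ Some i))"
  by (simp add: inner_vec_def matrix_vector_mult_def sum_option bordered_def sum_distrib_left
      sum_distrib_right algebra_simps sum.distrib power2_eq_square)

lemma symmetric_bordered: "symmetric (bordered x X) \<longleftrightarrow> symmetric X"
  by (auto simp: symmetric_def transpose_def vec_eq_iff bordered_def split: option.splits)

lemma outer_form: "v \<bullet> ((X - outer x x) *v v) = v \<bullet> (X *v v) - (v \<bullet> x)\<^sup>2"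
  by (simp add: matrix_vector_mult_diff_rdistrib outer_mult_vec inner_diff_right power2_eq_square
      inner_commute)

text \<open>With border coordinate \<open>s\<close>, the form of the bordered matrix at
  \<open>(s, v)\<close> is \<open>(s + v \<bullet> x)\<^sup>2\<close> plus the form of the Schur
  complement \<open>X - outer x x\<close> at \<open>v\<close>.\<close>

lemma psd_bordered_iff: "psd (bordered x X) \<longleftrightarrow> psd (X - outer x x)"
proof
  assume L: "psd (bordered x X)"
  show "psd (X - outer x x)"
    unfolding psd_def
  proof (intro conjI allI)
    show "symmetric (X - outer x x)"
      using L by (intro symmetric_diff symmetric_outer) (simp add: psd_def symmetric_bordered)
    fix v
    \<comment> \<open>This border coordinate makes the square vanish.\<close>
    define w where "w = (\<chi> r. case r of None \<Rightarrow> - (v \<bullet> x) | Some i \<Rightarrow> v $ i)"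
    have "0 \<le> w \<bullet> (bordered x X *v w)"
      using L by (simp add: psd_def)
    then show "0 \<le> v \<bullet> ((X - outer x x) *v v)"
      by (simp add: bordered_form outer_form w_def power2_eq_square)
  qed
next
  assume R: "psd (X - outer x x)"
  show "psd (bordered x X)"
    unfolding psd_def symmetric_bordered
  proof (intro conjI allI)
    show "symmetric X"
      using symmetric_add[of "X - outer x x" "outer x x"] R symmetric_outer[of x]
      by (simp add: psd_def)
    fix v :: "real^'a option"
    let ?v = "\<chi> i. v $ Some i"
    have "0 \<le> ?v \<bullet> ((X - outer x x) *v ?v)"
      using R unfolding psd_def by blast
    moreover have "0 \<le> (v $ None + ?v \<bullet> x)\<^sup>2" by simp
    ultimately show "0 \<le> v \<bullet> (bordered x X *v v)"
      by (simp add: bordered_form outer_mult_vec inner_commute power2_eq_square algebra_simps)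
  qed
qed

section \<open>Equivalence of the lifted redundant constraints\<close>

text \<open>\<open>transpose A ** A\<close> is the sum of the outer squares of the rows of
  \<open>A\<close>.\<close>

lemma gram_inner: "(transpose A ** A) \<bullet> Y = (\<Sum>i\<in>UNIV. A $ i \<bullet> (Y *v A $ i))"
  for A :: "real^'n^'q" and Y :: "real^'n^'n"
proof -
  have "(transpose A ** A) \<bullet> Y = (\<Sum>j\<in>UNIV. \<Sum>k\<in>UNIV. \<Sum>i\<in>UNIV. A $ i $ j * A $ i $ k * Y $ j $ k)"
    by (simp add: matrix_inner matrix_matrix_mult_def transpose_def sum_distrib_right)
  also have "\<dots> = (\<Sum>j\<in>UNIV. \<Sum>i\<in>UNIV. \<Sum>k\<in>UNIV. A $ i $ j * A $ i $ k * Y $ j $ k)"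
    by (intro sum.cong sum.swap refl)
  also have "\<dots> = (\<Sum>i\<in>UNIV. \<Sum>j\<in>UNIV. \<Sum>k\<in>UNIV. A $ i $ j * A $ i $ k * Y $ j $ k)"
    by (rule sum.swap)
  also have "\<dots> = (\<Sum>i\<in>UNIV. A $ i \<bullet> (Y *v A $ i))"
    by (simp add: inner_vec_def matrix_vector_mult_def sum_distrib_left mult_ac)
  finally show ?thesis .
qed

text \<open>With \<open>Y = X - x x\<^sup>T\<close>, condition (I) reads \<open>A\<^sub>i \<bullet> Y A\<^sub>i = 0\<close> summed over the rows
  \<open>A\<^sub>i\<close> of \<open>A\<close>, and condition (II) reads \<open>Y A\<^sub>i = 0\<close>.\<close>

lemma redundant_equivalence:
  fixes A :: "real^'n^'q"
  assumes Ax: "A *v x = b" and psd: "psd (bordered x X)"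
  shows "(transpose A ** A) \<bullet> X - 2 * (b \<bullet> (A *v x)) + b \<bullet> b = 0 \<longleftrightarrow>
    (\<forall>j i. (\<Sum>k\<in>UNIV. A $ i $ k * X $ j $ k) = x $ j * b $ i)"
proof -
  define Y where "Y = X - outer x x"
  have Y: "psd Y" using psd by (simp add: Y_def psd_bordered_iff)
  have b: "b $ i = A $ i \<bullet> x" for i
    using Ax by (auto simp: matrix_vector_mul_component)
  \<comment> \<open>The part \<open>outer x x\<close> of \<open>X\<close> cancels the linear and
    constant terms of (I), which leaves an expression in \<open>Y\<close> alone.\<close>
  have "(transpose A ** A) \<bullet> outer x x = b \<bullet> b"
    unfolding gram_inner by (simp add: outer_mult_vec b inner_vec_def[of b b] inner_commute)
  then have "(transpose A ** A) \<bullet> X - 2 * (b \<bullet> (A *v x)) + b \<bullet> b = (transpose A ** A) \<bullet> Y"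
    by (simp add: Y_def inner_diff_right Ax)
  also have "\<dots> = 0 \<longleftrightarrow> (\<forall>i. A $ i \<bullet> (Y *v A $ i) = 0)"
    unfolding gram_inner using Y by (subst sum_nonneg_eq_0_iff) (auto simp: psd_def)
  \<comment> \<open>A zero of a positive semidefinite form is a kernel vector; this turns scalar
    equations into vector equations.\<close>
  also have "\<dots> \<longleftrightarrow> (\<forall>i. Y *v A $ i = 0)"
    using psd_kernel[OF Y] by auto
  also have "\<dots> \<longleftrightarrow> (\<forall>i j. X $ j \<bullet> A $ i = b $ i * x $ j)"
    by (simp add: Y_def vec_eq_iff matrix_vector_mult_diff_rdistrib outer_mult_vec
        matrix_vector_mul_component b inner_commute)
  also have "\<dots> \<longleftrightarrow> (\<forall>j i. (\<Sum>k\<in>UNIV. A $ i $ k * X $ j $ k) = x $ j * b $ i)"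
    by (auto simp: inner_vec_def mult_ac)
  finally show ?thesis .
qed

text \<open>As \<open>X\<close> is symmetric, both halves of the symmetrized matrix have the same
  inner product with \<open>X\<close>, which leaves the plain row equation of (II).\<close>

lemma redundant_II_lifted_iff:
  assumes "symmetric X"
  shows "qmat (redundant_II A b) (j, i) \<bullet> X + qlin (redundant_II A b) (j, i) \<bullet> x
      = qrhs (redundant_II A b) $ (j, i)
    \<longleftrightarrow> (\<Sum>k\<in>UNIV. A $ i $ k * X $ j $ k) = x $ j * b $ i"
proof -
  have 1: "outer u v \<bullet> X = v \<bullet> (X *v u)" for u v
    using inner_outer[of X u v] symmetric_inner_commute[OF assms, of u v]
    by (simp add: inner_commute)
  have "A $ i \<bullet> (X *v axis j 1) = axis j 1 \<bullet> (X *v A $ i)"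
    by (rule symmetric_inner_commute[OF assms])
  also have "\<dots> = (\<Sum>k\<in>UNIV. A $ i $ k * X $ j $ k)"
    by (simp add: inner_axis' matrix_vector_mult_def mult_ac)
  finally have 2: "A $ i \<bullet> (X *v axis j 1) = (\<Sum>k\<in>UNIV. A $ i $ k * X $ j $ k)" .
  have "qmat (redundant_II A b) (j, i) \<bullet> X = (\<Sum>k\<in>UNIV. A $ i $ k * X $ j $ k)"
    using symmetric_inner_commute[OF assms, of "A $ i" "axis j 1"]
    by (simp add: redundant_II_def inner_add_left 1 2)
  then show ?thesis
    by (simp add: redundant_II_def inner_axis' mult_ac)
qed

lemma lifted_redundant_equivalence:
  assumes Ax: "A *v x = b" and psd: "psd (bordered x X)"
  shows "(\<forall>k. qmat (redundant_I A b) k \<bullet> X + qlin (redundant_I A b) k \<bullet> x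
          = qrhs (redundant_I A b) $ k) \<longleftrightarrow>
        (\<forall>k. qmat (redundant_II A b) k \<bullet> X + qlin (redundant_II A b) k \<bullet> x
          = qrhs (redundant_II A b) $ k)"
proof -
  have "symmetric X" using psd by (simp add: psd_def symmetric_bordered)
  then show ?thesis
    using redundant_equivalence[OF Ax psd]
    by (simp only: redundant_I_iff redundant_II_lifted_iff split_paired_All) simp
qed

text \<open>The equivalence presupposes the linear constraints and a positive semidefinite bordered
  matrix; membership in either set includes both.\<close>

lemma sdp_feasible_redundant_eq:
  "sdp_feasible P (redundant_I (lin_mat P) (lin_rhs P))
     = sdp_feasible P (redundant_II (lin_mat P) (lin_rhs P))" (is "?F = ?G")
proof -
  have "(x, X) \<in> ?F \<longleftrightarrow> (x, X) \<in> ?G" for x X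
  proof (cases "lin_mat P *v x = lin_rhs P \<and> psd (bordered x X)")
    case True
    then have Ax: "lin_mat P *v x = lin_rhs P" and psd: "psd (bordered x X)" by auto
    show ?thesis
      unfolding sdp_feasible_def mem_Collect_eq case_prod_conv
        lifted_redundant_equivalence[OF Ax psd] ..
  next
    case False
    then show ?thesis
      unfolding sdp_feasible_def mem_Collect_eq case_prod_conv by argo
  qed
  then show ?thesis by (intro set_eqI) (simp add: split_paired_all)
qed

section \<open>Lagrangians and weak duality\<close>

text \<open>One function serves both duals: the total Lagrangian evaluates it at
  \<open>X = outer x x\<close> and adds the \<beta> term, the partial one keeps the lifted variable
  \<open>X\<close>.\<close>

definition lagrangian ::
  "('n::finite, 'p::finite, 'q::finite) qprog \<Rightarrow> ('n, 'r::finite) qcons \<Rightarrow>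
   real^'p \<Rightarrow> real^'r \<Rightarrow> real^'n \<Rightarrow> real^'n^'n \<Rightarrow> real" where
  "lagrangian P R \<mu> \<nu> x X = lag_mat P R \<mu> \<nu> \<bullet> X + lag_vec P R \<mu> \<nu> \<bullet> x - lag_const P R \<mu> \<nu>"

lemma lagrangian_altdef:
  "lagrangian P R \<mu> \<nu> x X = obj_mat P \<bullet> X + obj_vec P \<bullet> x
     + (\<Sum>i\<in>UNIV. \<mu> $ i * (qmat (cons P) i \<bullet> X + qlin (cons P) i \<bullet> x - qrhs (cons P) $ i))
     + (\<Sum>j\<in>UNIV. \<nu> $ j * (qmat R j \<bullet> X + qlin R j \<bullet> x - qrhs R $ j))"
  by (simp add: lagrangian_def lag_mat_def lag_vec_def lag_const_def inner_add_left inner_sum_left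
      inner_vec_def[of \<mu>] inner_vec_def[of \<nu>] algebra_simps sum.distrib sum_subtractf)

lemma total_lagrangian_value_altdef:
  "total_lagrangian_value P R =
     (SUP (\<mu>, \<nu>, \<beta>) \<in> multipliers P \<times> UNIV \<times> UNIV. INF x.
        ereal (lagrangian P R \<mu> \<nu> x (outer x x) + \<beta> \<bullet> (lin_mat P *v x - lin_rhs P)))"
  by (simp add: total_lagrangian_value_def lagrangian_def inner_add_left dot_lmul_matrix
      inner_diff_right algebra_simps)

lemma partial_lagrangian_value_altdef:
  "partial_lagrangian_value P R =
     (SUP (\<mu>, \<nu>) \<in> multipliers P \<times> UNIV.
        INF (x, X) \<in> {(x, X). lin_mat P *v x = lin_rhs P \<and> psd (bordered x X)}.
          ereal (lagrangian P R \<mu> \<nu> x X))"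
  by (simp add: partial_lagrangian_value_def lagrangian_def)

text \<open>At a feasible point the \<mu> terms are nonpositive and the \<nu> terms vanish, so the
  Lagrangian is at most the objective.\<close>

lemma partial_le_sdp: "partial_lagrangian_value P R \<le> sdp_value P R"
  unfolding partial_lagrangian_value_altdef sdp_value_def
proof (intro SUP_least INF_greatest, clarsimp)
  fix \<mu> :: "real^'b" and \<nu> :: "real^'d" and x X
  assume \<mu>: "\<mu> \<in> multipliers P" and f: "(x, X) \<in> sdp_feasible P R"
  have "\<mu> $ i * (qmat (cons P) i \<bullet> X + qlin (cons P) i \<bullet> x - qrhs (cons P) $ i) \<le> 0" for i
    using \<mu> f by (cases "i \<in> ineqs P")
      (auto simp: multipliers_def sdp_feasible_def mult_nonneg_nonpos split: if_splits)
  then have "(\<Sum>i\<in>UNIV. \<mu> $ i * (qmat (cons P) i \<bullet> X + qlin (cons P) i \<bullet> x - qrhs (cons P) $ i)) \<le> 0"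
    by (intro sum_nonpos)
  moreover have "(\<Sum>j\<in>UNIV. \<nu> $ j * (qmat R j \<bullet> X + qlin R j \<bullet> x - qrhs R $ j)) = 0"
    using f by (simp add: sdp_feasible_def)
  ultimately have "lagrangian P R \<mu> \<nu> x X \<le> obj_mat P \<bullet> X + obj_vec P \<bullet> x"
    by (simp add: lagrangian_altdef)
  moreover have "(x, X) \<in> {(x, X). lin_mat P *v x = lin_rhs P \<and> psd (bordered x X)}"
    using f by (simp add: sdp_feasible_def)
  ultimately show "(INF (x, X) \<in> {(x, X). lin_mat P *v x = lin_rhs P \<and> psd (bordered x X)}.
      ereal (lagrangian P R \<mu> \<nu> x X)) \<le> ereal (obj_mat P \<bullet> X + obj_vec P \<bullet> x)"
    by - (rule INF_lower2[where i = "(x, X)"], simp_all)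
qed

text \<open>Along the line through \<open>v\<close> the function is a quadratic in \<open>s\<close>
  that is bounded below, with the form at \<open>v\<close> as leading coefficient.\<close>

lemma quadratic_bounded_below:
  assumes bd: "\<And>x. r \<le> M \<bullet> outer x x + c \<bullet> x + k"
  shows "0 \<le> v \<bullet> (M *v v)"
proof (rule quadratic_nonneg_leading)
  fix s :: real
  show "0 \<le> (k - r) + s * (c \<bullet> v) + s\<^sup>2 * (v \<bullet> (M *v v))"
    using bd[of "s *\<^sub>R v"] by (simp add: inner_outer matrix_vector_mult_scaleR power2_eq_square mult.assoc)
qed

text \<open>A quadratic function that is bounded below has a positive semidefinite quadratic part,
  so that lifting \<open>x x\<^sup>T\<close> to \<open>X\<close> does not decrease it.\<close>

lemma quadratic_INF_le_lifted:
  fixes M :: "real^'n^'n"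
  assumes psd: "psd (bordered x X)"
  shows "(INF y. ereal (M \<bullet> outer y y + c \<bullet> y + k)) \<le> ereal (M \<bullet> X + c \<bullet> x + k)"
    (is "(INF y. ?q y) \<le> _")
proof (rule dense_le)
  \<comment> \<open>A real \<open>w\<close> below the infimum is a lower bound of the quadratic
    function. An infimum of minus infinity leaves no \<open>w\<close> to treat.\<close>
  fix w assume w: "w < (INF y. ?q y)"
  show "w \<le> ereal (M \<bullet> X + c \<bullet> x + k)"
  proof (cases w)
    case (real r)
    have bd: "r \<le> M \<bullet> outer y y + c \<bullet> y + k" for y
    proof -
      have "ereal r \<le> ?q y"
        using less_le_trans[OF w INF_lower[of y UNIV ?q]] real by simp
      then show ?thesis by simp
    qed
    have "0 \<le> M \<bullet> (X - outer x x)"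
      by (rule inner_psd_nonneg[OF quadratic_bounded_below[OF bd]])
        (use psd in \<open>simp add: psd_bordered_iff\<close>)
    then show ?thesis
      using bd[of x] real by (simp add: inner_diff_right)
  next
    case PInf
    then show ?thesis using w by simp
  qed simp
qed

text \<open>The infimum over \<open>outer x x\<close> is at most the value at any lifted pair. At
  pairs that satisfy the linear constraints the \<beta> term vanishes, so the same \<mu> and \<nu>
  serve in the partial dual.\<close>

lemma total_le_partial: "total_lagrangian_value P R \<le> partial_lagrangian_value P R"
  unfolding total_lagrangian_value_altdef partial_lagrangian_value_altdef
proof (intro SUP_least, clarsimp)
  fix \<mu> :: "real^'b" and \<nu> :: "real^'d" and \<beta> :: "real^'c"
  assume \<mu>: "\<mu> \<in> multipliers P"
  let ?c = "lag_vec P R \<mu> \<nu> + transpose (lin_mat P) *v \<beta>"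
  let ?k = "- lag_const P R \<mu> \<nu> - \<beta> \<bullet> lin_rhs P"
  have eq: "lagrangian P R \<mu> \<nu> x X + \<beta> \<bullet> (lin_mat P *v x - lin_rhs P)
      = lag_mat P R \<mu> \<nu> \<bullet> X + ?c \<bullet> x + ?k" for x X
    by (simp add: lagrangian_def inner_add_left dot_lmul_matrix inner_diff_right)
  have "(INF x. ereal (lagrangian P R \<mu> \<nu> x (outer x x) + \<beta> \<bullet> (lin_mat P *v x - lin_rhs P)))
      \<le> ereal (lagrangian P R \<mu> \<nu> x X)"
    if "lin_mat P *v x = lin_rhs P" "psd (bordered x X)" for x X
    using quadratic_INF_le_lifted[OF that(2), of "lag_mat P R \<mu> \<nu>" ?c ?k]
    unfolding eq[symmetric] using that(1) by simp
  then have "(INF x. ereal (lagrangian P R \<mu> \<nu> x (outer x x) + \<beta> \<bullet> (lin_mat P *v x - lin_rhs P)))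
      \<le> (INF (x, X) \<in> {(x, X). lin_mat P *v x = lin_rhs P \<and> psd (bordered x X)}.
          ereal (lagrangian P R \<mu> \<nu> x X))"
    by (intro INF_greatest) auto
  also have "\<dots> \<le> (SUP (\<mu>, \<nu>) \<in> multipliers P \<times> UNIV.
        INF (x, X) \<in> {(x, X). lin_mat P *v x = lin_rhs P \<and> psd (bordered x X)}.
          ereal (lagrangian P R \<mu> \<nu> x X))"
    by (rule SUP_upper2[of "(\<mu>, \<nu>)"]) (use \<mu> in auto)
  finally show "(INF x. ereal (lagrangian P R \<mu> \<nu> x (outer x x)
        + \<beta> \<bullet> (lin_mat P *v x - lin_rhs P)))
      \<le> (SUP (\<mu>, \<nu>) \<in> multipliers P \<times> UNIV.
        INF (x, X) \<in> {(x, X). lin_mat P *v x = lin_rhs P \<and> psd (bordered x X)}.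
          ereal (lagrangian P R \<mu> \<nu> x X))" .
qed

section \<open>A compact base of the homogenized cone\<close>

lemma outer_scaleR: "outer (k *\<^sub>R x) (l *\<^sub>R y) = (k * l) *\<^sub>R outer x y"
  by (simp add: outer_def vec_eq_iff mult_ac)

lemma trace_scaleR: "trace (k *\<^sub>R X) = k * trace X"
  for X :: "real^'n^'n"
  by (simp add: trace_def sum_distrib_left)

lemma trace_outer: "trace (outer x x) = x \<bullet> x"
  by (simp add: trace_def outer_def inner_vec_def)

text \<open>The triples \<open>(t, x, X)\<close> stand for the matrices with blocks \<open>t\<close>, \<open>x\<^sup>T\<close>, \<open>x\<close>, \<open>X\<close>.
  The convex hull below is a compact base of the cone of positive semidefinite ones.\<close>

definition lift :: "real \<times> (real^'n) \<Rightarrow> real \<times> (real^'n) \<times> (real^'n^'n)" where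
  "lift y = ((fst y)\<^sup>2, fst y *\<^sub>R snd y, outer (snd y) (snd y))"

definition psd_base :: "(real \<times> (real^'n) \<times> (real^'n^'n)) set" where
  "psd_base = convex hull (lift ` sphere 0 1)"

lemma continuous_on_lift: "continuous_on S lift"
  unfolding lift_def[abs_def] outer_def
  by (intro continuous_intros)

lemma compact_psd_base: "compact psd_base"
  unfolding psd_base_def
  by (intro compact_convex_hull compact_continuous_image continuous_on_lift compact_sphere)

text \<open>The conditions hold for lifts of unit vectors, where the form is a square, and define a
  convex set, so they pass to the hull.\<close>

lemma psd_baseD:
  assumes "(t, x, X) \<in> psd_base"
  shows "symmetric X" "0 \<le> s\<^sup>2 * t + 2 * s * (v \<bullet> x) + v \<bullet> (X *v v)" "t + trace X = 1"
proof -
  define C :: "(real \<times> (real^'a) \<times> (real^'a^'a)) set" where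
    "C = {(t, x, X). symmetric X \<and> (\<forall>s v. 0 \<le> s\<^sup>2 * t + 2 * s * (v \<bullet> x) + v \<bullet> (X *v v)) \<and>
      t + trace X = 1}"
  have "psd_base \<subseteq> C"
    unfolding psd_base_def
  proof (rule hull_minimal)
    show "lift ` sphere 0 1 \<subseteq> C"
    proof (clarsimp simp: C_def lift_def symmetric_outer trace_outer)
      fix t :: real and x :: "real^'a"
      assume "norm (t, x) = 1"
      then have "t\<^sup>2 + x \<bullet> x = 1"
        by (simp add: norm_Pair flip: power2_norm_eq_inner)
      moreover have "s\<^sup>2 * t\<^sup>2 + 2 * s * (v \<bullet> (t *\<^sub>R x)) + v \<bullet> (outer x x *v v)
          = (s * t + v \<bullet> x)\<^sup>2" for s v
        by (simp add: outer_mult_vec power2_eq_square inner_commute algebra_simps)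
      ultimately show "(\<forall>s v. 0 \<le> s\<^sup>2 * t\<^sup>2 + 2 * s * (t * (v \<bullet> x)) + v \<bullet> (outer x x *v v)) \<and>
          t\<^sup>2 + x \<bullet> x = 1"
        by (metis inner_scaleR_right zero_le_power2)
    qed
    show "convex C"
    proof (rule convexI)
      fix Z W :: "real \<times> (real^'a) \<times> (real^'a^'a)" and k l :: real
      assume Z: "Z \<in> C" and W: "W \<in> C" and k: "0 \<le> k" and l: "0 \<le> l" and kl: "k + l = 1"
      obtain t x X where Ze: "Z = (t, x, X)" by (cases Z)
      obtain u y Y where We: "W = (u, y, Y)" by (cases W)
      have "0 \<le> s\<^sup>2 * (k * t + l * u) + 2 * s * (v \<bullet> (k *\<^sub>R x + l *\<^sub>R y))
          + v \<bullet> ((k *\<^sub>R X + l *\<^sub>R Y) *v v)" for s v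
      proof -
        have "0 \<le> k * (s\<^sup>2 * t + 2 * s * (v \<bullet> x) + v \<bullet> (X *v v))
            + l * (s\<^sup>2 * u + 2 * s * (v \<bullet> y) + v \<bullet> (Y *v v))"
          by (rule add_nonneg_nonneg; rule mult_nonneg_nonneg)
            (use Z W k l in \<open>auto simp: Ze We C_def\<close>)
        then show ?thesis
          by (simp add: matrix_vector_mult_add_rdistrib scaleR_matrix_vector_assoc[symmetric]
              inner_add_right algebra_simps)
      qed
      moreover have "k * t + l * u + trace (k *\<^sub>R X + l *\<^sub>R Y) = 1"
      proof -
        have "k * t + l * u + trace (k *\<^sub>R X + l *\<^sub>R Y) = k * (t + trace X) + l * (u + trace Y)"
          by (simp add: trace_add trace_scaleR algebra_simps)
        then show ?thesis using Z W kl unfolding Ze We C_def by simp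
      qed
      moreover have "symmetric (k *\<^sub>R X + l *\<^sub>R Y)"
        using Z W unfolding Ze We C_def by (auto intro: symmetric_add symmetric_scaleR)
      ultimately show "k *\<^sub>R Z + l *\<^sub>R W \<in> C"
        by (simp add: Ze We C_def)
    qed
  qed
  then have "(t, x, X) \<in> C" using assms by blast
  then show "symmetric X" "0 \<le> s\<^sup>2 * t + 2 * s * (v \<bullet> x) + v \<bullet> (X *v v)" "t + trace X = 1"
    by (simp_all add: C_def)
qed

lemma psd_base_fst_nonneg: "(t, x, X) \<in> psd_base \<Longrightarrow> 0 \<le> t"
  using psd_baseD(2)[of t x X 1 0] by simp

text \<open>Division by \<open>t\<close> makes the corner entry 1, and the discriminant condition in
  \<open>s\<close> becomes semidefiniteness of the Schur complement.\<close>

lemma psd_base_normalize: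
  assumes Z: "(t, x, X) \<in> psd_base" and t: "0 < t"
  shows "psd (bordered ((1/t) *\<^sub>R x) ((1/t) *\<^sub>R X))"
  unfolding psd_bordered_iff unfolding psd_def
proof (intro conjI allI)
  show "symmetric ((1/t) *\<^sub>R X - outer ((1/t) *\<^sub>R x) ((1/t) *\<^sub>R x))"
    by (simp add: symmetric_diff symmetric_scaleR symmetric_outer psd_baseD(1)[OF Z])
  fix v
  have "v \<bullet> (((1/t) *\<^sub>R X - outer ((1/t) *\<^sub>R x) ((1/t) *\<^sub>R x)) *v v)
      = (v \<bullet> (X *v v) * t - (v \<bullet> x)\<^sup>2) / t\<^sup>2"
    using t by (simp add: outer_form scaleR_matrix_vector_assoc[symmetric] field_simps power2_eq_square)
  moreover have "(v \<bullet> x)\<^sup>2 \<le> v \<bullet> (X *v v) * t"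
    using psd_baseD(2)[OF Z] by (intro quadratic_nonneg_discriminant) (simp add: algebra_simps)
  ultimately show "0 \<le> v \<bullet> (((1/t) *\<^sub>R X - outer ((1/t) *\<^sub>R x) ((1/t) *\<^sub>R x)) *v v)"
    by simp
qed

text \<open>With corner entry 0, the discriminant condition at \<open>v = x\<close> forces
  \<open>x \<bullet> x = 0\<close>.\<close>

lemma psd_base_fst_zero:
  assumes Z: "(0, x, X) \<in> psd_base"
  shows "x = 0"
proof -
  have "(x \<bullet> x)\<^sup>2 \<le> x \<bullet> (X *v x) * 0"
    using psd_baseD(2)[OF Z] by (intro quadratic_nonneg_discriminant) (simp add: algebra_simps)
  then show ?thesis by simp
qed

section \<open>Homogenized residuals and separation\<close>

text \<open>The right-hand sides and the target value \<open>r\<close> are multiplied by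
  \<open>t\<close>, which makes the map linear; the last component compares the objective with
  \<open>r\<close>.\<close>

definition residuals ::
  "('n::finite, 'p::finite, 'q::finite) qprog \<Rightarrow> ('n, 'r::finite) qcons \<Rightarrow> real \<Rightarrow>
   real \<times> (real^'n) \<times> (real^'n^'n) \<Rightarrow> (real^'p) \<times> (real^'r) \<times> (real^'q) \<times> real" where
  "residuals P R r = (\<lambda>(t, x, X).
     (\<chi> i. qmat (cons P) i \<bullet> X + qlin (cons P) i \<bullet> x - qrhs (cons P) $ i * t,
      \<chi> j. qmat R j \<bullet> X + qlin R j \<bullet> x - qrhs R $ j * t,
      lin_mat P *v x - t *\<^sub>R lin_rhs P,
      obj_mat P \<bullet> X + obj_vec P \<bullet> x - r * t))"

lemma linear_residuals: "linear (residuals P R r)"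
  by (rule linearI)
    (auto simp: residuals_def vec_eq_iff inner_add_right matrix_vector_right_distrib
      matrix_vector_mult_scaleR ring_distribs mult.left_commute)

text \<open>The closed convex cone in which the residuals lie, at \<open>t = 1\<close>, for a
  feasible pair of objective value at most \<open>r\<close>.\<close>

definition admissible ::
  "('n::finite, 'p::finite, 'q::finite) qprog \<Rightarrow> ((real^'p) \<times> (real^'r) \<times> (real^'q) \<times> real) set" where
  "admissible P = {y. (\<forall>i. fst y $ i \<le> 0) \<and> (\<forall>i. i \<notin> ineqs P \<longrightarrow> fst y $ i = 0)
     \<and> fst (snd y) = 0 \<and> fst (snd (snd y)) = 0 \<and> snd (snd (snd y)) \<le> 0}"

lemma closed_admissible:
  fixes P :: "('n::finite, 'b::finite, 'c::finite) qprog"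
  shows "closed (admissible P :: ((real^'b) \<times> (real^'a) \<times> (real^'c) \<times> real) set)"
  unfolding admissible_def
  by (intro closed_Collect_conj closed_Collect_all closed_Collect_imp closed_Collect_le
      closed_Collect_eq open_Collect_const continuous_intros)

lemma convex_admissible:
  fixes P :: "('n::finite, 'b::finite, 'c::finite) qprog"
  shows "convex (admissible P :: ((real^'b) \<times> (real^'a) \<times> (real^'c) \<times> real) set)"
proof (rule convexI)
  fix y z :: "(real^'b) \<times> (real^'a) \<times> (real^'c) \<times> real" and k l :: real
  assume "y \<in> admissible P" "z \<in> admissible P" "0 \<le> k" "0 \<le> l"
  then show "k *\<^sub>R y + l *\<^sub>R z \<in> admissible P"
    by (auto simp: admissible_def intro!: add_nonpos_nonpos mult_nonneg_nonpos)
qed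

text \<open>An admissible point of the base with \<open>t > 0\<close> would rescale to a feasible point of objective
  value at most \<open>r\<close>. If \<open>t = 0\<close> then \<open>x = 0\<close>, and the constraints \<open>X\<^sub>i\<^sub>i = x\<^sub>i\<close> of the 0-1 case
  force the trace to vanish as well.\<close>

lemma residuals_not_admissible:
  assumes zo: "zero_one P" and r: "ereal r < sdp_value P R" and Z: "Z \<in> psd_base"
  shows "residuals P R r Z \<notin> admissible P"
proof
  assume adm: "residuals P R r Z \<in> admissible P"
  obtain t x X where Ze: "Z = (t, x, X)" by (cases Z)
  note Z = Z[unfolded Ze]
  have cons: "if i \<in> ineqs P
      then qmat (cons P) i \<bullet> X + qlin (cons P) i \<bullet> x \<le> qrhs (cons P) $ i * t
      else qmat (cons P) i \<bullet> X + qlin (cons P) i \<bullet> x = qrhs (cons P) $ i * t" for i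
    using adm by (auto simp: Ze residuals_def admissible_def split: if_splits)
  have red: "qmat R j \<bullet> X + qlin R j \<bullet> x = qrhs R $ j * t" for j
    using adm by (auto simp: Ze residuals_def admissible_def vec_eq_iff)
  have lin: "lin_mat P *v x = t *\<^sub>R lin_rhs P" and obj: "obj_mat P \<bullet> X + obj_vec P \<bullet> x \<le> r * t"
    using adm by (auto simp: Ze residuals_def admissible_def)
  show False
  proof (cases "t = 0")
    case True
    have x: "x = 0" using psd_base_fst_zero Z True by blast
    obtain \<iota> where \<iota>: "\<And>i. \<iota> i \<notin> ineqs P"
      "\<And>i. qmat (cons P) (\<iota> i) = outer (axis i 1) (axis i 1)"
      using zo unfolding zero_one_def by blast
    have "X $ i $ i = 0" for i
      using cons[of "\<iota> i"] \<iota>[of i] True x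
      by (simp add: inner_commute[of _ X] inner_outer axis_inner_mult_axis)
    then show False
      using psd_baseD(3)[OF Z] True by (simp add: trace_def)
  next
    case False
    then have t: "0 < t" using psd_base_fst_nonneg[OF Z] by simp
    let ?x = "(1/t) *\<^sub>R x" and ?X = "(1/t) *\<^sub>R X"
    have scale: "M \<bullet> ?X + c \<bullet> ?x = (M \<bullet> X + c \<bullet> x) / t" for M and c
      by (simp add: add_divide_distrib)
    have "(?x, ?X) \<in> sdp_feasible P R"
      unfolding sdp_feasible_def
    proof (clarify, intro conjI allI)
      show "lin_mat P *v ?x = lin_rhs P"
        using lin t by (simp add: matrix_vector_mult_scaleR)
      show "qmat R j \<bullet> ?X + qlin R j \<bullet> ?x = qrhs R $ j" for j
        unfolding scale using red[of j] t by simp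
      show "if i \<in> ineqs P
          then qmat (cons P) i \<bullet> ?X + qlin (cons P) i \<bullet> ?x \<le> qrhs (cons P) $ i
          else qmat (cons P) i \<bullet> ?X + qlin (cons P) i \<bullet> ?x = qrhs (cons P) $ i" for i
        unfolding scale using cons[of i] t by (simp add: divide_le_eq split: if_splits)
      show "psd (bordered ?x ?X)"
        by (rule psd_base_normalize[OF Z t])
    qed
    then have "sdp_value P R \<le> ereal (obj_mat P \<bullet> ?X + obj_vec P \<bullet> ?x)"
      unfolding sdp_value_def by (rule INF_lower2) simp
    also have "\<dots> \<le> ereal r"
      unfolding scale using obj t by (simp add: divide_le_eq)
    finally show False using r by simp
  qed
qed

text \<open>Strict separation of the residuals of the compact base from the admissible cone yields
  multipliers. Strictness allows a small increase of the multiplier of the objective, which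
  makes it positive without a constraint qualification.\<close>

lemma separating_multipliers:
  fixes P :: "('n::finite, 'p::finite, 'q::finite) qprog" and R :: "('n, 'r::finite) qcons"
  assumes zo: "zero_one P" and r: "ereal r < sdp_value P R"
  obtains \<mu> \<nu> \<beta> where "\<mu> \<in> multipliers P" "\<And>Z. Z \<in> psd_base \<Longrightarrow> 0 \<le> (\<mu>, \<nu>, \<beta>, 1) \<bullet> residuals P R r Z"
proof -
  have lin: "linear (residuals P R r)" by (rule linear_residuals)
  have compact: "compact (residuals P R r ` psd_base)"
    by (intro compact_continuous_image compact_psd_base linear_continuous_on
        linear_conv_bounded_linear[THEN iffD1] lin)
  have "convex (residuals P R r ` psd_base)"
    by (intro convex_linear_image lin) (simp add: psd_base_def)
  moreover have zero: "0 \<in> admissible P" by (simp add: admissible_def)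
  moreover have "admissible P \<inter> residuals P R r ` psd_base = {}"
    using residuals_not_admissible[OF zo r] by blast
  moreover have "residuals P R r ` psd_base \<noteq> {}"
    by (auto simp: psd_base_def)
  ultimately obtain a b where
    adm: "\<And>y. y \<in> admissible P \<Longrightarrow> a \<bullet> y < b" and
    base: "\<And>Z. Z \<in> psd_base \<Longrightarrow> b < a \<bullet> residuals P R r Z"
    using separating_hyperplane_closed_compact[OF convex_admissible closed_admissible _ compact]
    by (metis imageI)
  obtain \<mu> \<nu> \<beta> l where a: "a = (\<mu>, \<nu>, \<beta>, l)" by (cases a)
  have b: "0 < b" using adm[OF zero] by simp
  \<comment> \<open>Scaling \<open>y\<close> to the value \<open>b\<close> would stay in the cone
    and contradict the strict inequality there.\<close>
  have cone: "a \<bullet> y \<le> 0" if "y \<in> admissible P" for y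
  proof (rule ccontr)
    assume "\<not> a \<bullet> y \<le> 0"
    then have "b / (a \<bullet> y) > 0" and pos: "a \<bullet> y > 0" using b by auto
    then have "(b / (a \<bullet> y)) *\<^sub>R y \<in> admissible P"
      using that b by (auto simp: admissible_def intro!: divide_nonpos_pos mult_nonneg_nonpos)
    then show False using adm pos by fastforce
  qed
  \<comment> \<open>The signs of the multipliers come from testing negative unit vectors in the
    cone.\<close>
  have l: "0 \<le> l" using cone[of "(0, 0, 0, -1)"] by (simp add: a admissible_def)
  have \<mu>: "0 \<le> \<mu> $ i" if "i \<in> ineqs P" for i
    using cone[of "(- axis i 1, 0, 0, 0)"] that
    by (simp add: a admissible_def inner_axis) (auto simp: axis_def)
  obtain C where C: "0 < C" "\<And>Z. Z \<in> psd_base \<Longrightarrow> norm (residuals P R r Z) \<le> C"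
    using compact_imp_bounded[OF compact] unfolding bounded_pos by auto
  \<comment> \<open>The objective residual is at most \<open>C\<close> in absolute value, so adding
    \<open>b / C\<close> changes the pairing by at most \<open>b\<close>, while the pairing exceeds
    \<open>b\<close> on the base.\<close>
  define l' where "l' = l + b / C"
  have l': "0 < l'" unfolding l'_def using l b C(1) by (intro add_nonneg_pos divide_pos_pos)
  have pos: "0 \<le> (\<mu>, \<nu>, \<beta>, l') \<bullet> residuals P R r Z" if "Z \<in> psd_base" for Z
  proof -
    let ?g = "snd (snd (snd (residuals P R r Z)))"
    obtain u w z g where res: "residuals P R r Z = (u, w, z, g)" by (cases "residuals P R r Z")
    have "\<bar>?g\<bar> \<le> norm (residuals P R r Z)"
      using norm_snd_le[of g z] norm_snd_le[of "(z, g)" w] norm_snd_le[of "(w, z, g)" u]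
      unfolding res snd_conv real_norm_def by linarith
    then have "\<bar>?g\<bar> \<le> C" using C(2)[OF that] by simp
    then have "(b / C) * (- C) \<le> (b / C) * ?g"
      using b C(1) by (intro mult_left_mono) auto
    then have "- b \<le> (b / C) * ?g" using C(1) by simp
    moreover have "(\<mu>, \<nu>, \<beta>, l') \<bullet> residuals P R r Z = a \<bullet> residuals P R r Z + (b / C) * ?g"
      by (simp add: a l'_def inner_prod_def algebra_simps)
    ultimately show ?thesis using base[OF that] by simp
  qed
  have "0 \<le> ((1/l') *\<^sub>R \<mu>, (1/l') *\<^sub>R \<nu>, (1/l') *\<^sub>R \<beta>, 1) \<bullet> residuals P R r Z"
    if "Z \<in> psd_base" for Z
  proof -
    have "((1/l') *\<^sub>R \<mu>, (1/l') *\<^sub>R \<nu>, (1/l') *\<^sub>R \<beta>, 1) = (1/l') *\<^sub>R (\<mu>, \<nu>, \<beta>, l')"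
      using l' by simp
    then show ?thesis
      using pos[OF that] l' by (simp only: inner_scaleR_left) simp
  qed
  moreover have "(1/l') *\<^sub>R \<mu> \<in> multipliers P"
    using \<mu> l' by (simp add: multipliers_def)
  ultimately show thesis by (rule that[rotated])
qed

section \<open>Strong duality and the common value\<close>

text \<open>For real \<open>r\<close> below the SDP value, the separating inequality at rank one
  points bounds the Lagrangian below by \<open>r\<close>. An infeasible relaxation is included:
  \<open>r\<close> is then arbitrary.\<close>

lemma sdp_le_total:
  fixes P :: "('n::finite, 'p::finite, 'q::finite) qprog" and R :: "('n, 'r::finite) qcons"
  assumes zo: "zero_one P"
  shows "sdp_value P R \<le> total_lagrangian_value P R"
proof (rule dense_le)
  fix w assume w: "w < sdp_value P R"
  show "w \<le> total_lagrangian_value P R"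
  proof (cases w)
    case (real r)
    obtain \<mu> \<nu> \<beta> where \<mu>: "\<mu> \<in> multipliers P"
      and sep: "\<And>Z. Z \<in> psd_base \<Longrightarrow> 0 \<le> (\<mu>, \<nu>, \<beta>, 1) \<bullet> residuals P R r Z"
      using separating_multipliers[OF zo, of r R] w real by blast
    have "r \<le> lagrangian P R \<mu> \<nu> x (outer x x) + \<beta> \<bullet> (lin_mat P *v x - lin_rhs P)" for x
    proof -
      \<comment> \<open>Scaling by \<open>1/k\<close> moves \<open>(1, x)\<close> onto the unit
        sphere; \<open>lift\<close> is quadratic, so the positive factor
        \<open>(1/k)\<^sup>2\<close> comes out of the linear residuals.\<close>
      define k where "k = norm (1::real, x)"
      have k: "0 < k" by (simp add: k_def zero_prod_def)
      have "lift ((1/k) *\<^sub>R (1, x)) \<in> psd_base"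
      proof -
        have "norm ((1/k) *\<^sub>R (1::real, x)) = 1"
          unfolding norm_scaleR using k by (simp flip: k_def)
        then show ?thesis
          unfolding psd_base_def by (intro hull_inc imageI) (simp only: mem_sphere_0)
      qed
      moreover have "lift ((1/k) *\<^sub>R (1, x)) = (1/k)\<^sup>2 *\<^sub>R (1, x, outer x x)"
        by (simp add: lift_def outer_scaleR power2_eq_square)
      ultimately have "0 \<le> (1/k)\<^sup>2 * ((\<mu>, \<nu>, \<beta>, 1) \<bullet> residuals P R r (1, x, outer x x))"
        using sep[of "lift ((1/k) *\<^sub>R (1, x))"]
        by (simp only: linear_scale[OF linear_residuals] inner_scaleR_right)
      then have "0 \<le> (\<mu>, \<nu>, \<beta>, 1) \<bullet> residuals P R r (1, x, outer x x)"
        using k by (simp add: zero_le_mult_iff)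
      \<comment> \<open>With objective multiplier 1 and \<open>t = 1\<close>, the pairing is the
        full Lagrangian minus \<open>r\<close>.\<close>
      also have "\<dots> = lagrangian P R \<mu> \<nu> x (outer x x) + \<beta> \<bullet> (lin_mat P *v x - lin_rhs P) - r"
        by (simp add: residuals_def lagrangian_altdef inner_vec_def[of \<mu>] inner_vec_def[of \<nu>])
      finally show ?thesis by simp
    qed
    then have "w \<le> (INF x. ereal (lagrangian P R \<mu> \<nu> x (outer x x)
        + \<beta> \<bullet> (lin_mat P *v x - lin_rhs P)))"
      unfolding real by (intro INF_greatest) simp
    also have "\<dots> \<le> total_lagrangian_value P R"
      unfolding total_lagrangian_value_altdef
      by (rule SUP_upper2[of "(\<mu>, \<nu>, \<beta>)"]) (use \<mu> in auto)
    finally show ?thesis .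
  next
    case PInf
    then show ?thesis using w by simp
  qed simp
qed

text \<open>The chain \<open>S \<le> TL \<le> PL \<le> S\<close> closes for each family
  \<open>R\<close> separately.\<close>

lemma lagrangian_values_eq_sdp:
  assumes "zero_one P"
  shows "total_lagrangian_value P R = sdp_value P R" "partial_lagrangian_value P R = sdp_value P R"
  using sdp_le_total[OF assms, of R] total_le_partial[of P R] partial_le_sdp[of P R] by auto

theorem proposition8:
  fixes A :: "real^'n^'q" and b :: "real^'q"
  shows "(\<forall>(x :: real^'n) (X :: real^'n^'n).
            symmetric X \<and> A *v x = b \<and> psd (bordered x X) \<longrightarrow>
              ((transpose A ** A) \<bullet> X - 2 * (b \<bullet> (A *v x)) + b \<bullet> b = 0 \<longleftrightarrow>
               (\<forall>j i. (\<Sum>k\<in>UNIV. A $ i $ k * X $ j $ k) = x $ j * b $ i)))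
       \<and> (\<forall>P :: ('n, 'p::finite, 'q) qprog.
            symmetric_data P \<and> zero_one P \<and> lin_mat P = A \<and> lin_rhs P = b \<longrightarrow>
              total_lagrangian_value P (redundant_I A b)
                = total_lagrangian_value P (redundant_II A b) \<and>
              total_lagrangian_value P (redundant_II A b)
                = partial_lagrangian_value P (redundant_I A b) \<and>
              partial_lagrangian_value P (redundant_I A b)
                = partial_lagrangian_value P (redundant_II A b) \<and>
              partial_lagrangian_value P (redundant_II A b)
                = sdp_value P (redundant_I A b) \<and>
              sdp_value P (redundant_I A b) = sdp_value P (redundant_II A b))"
proof (rule conjI)
  show "\<forall>(x :: real^'n) (X :: real^'n^'n).
            symmetric X \<and> A *v x = b \<and> psd (bordered x X) \<longrightarrow>
              ((transpose A ** A) \<bullet> X - 2 * (b \<bullet> (A *v x)) + b \<bullet> b = 0 \<longleftrightarrow>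
               (\<forall>j i. (\<Sum>k\<in>UNIV. A $ i $ k * X $ j $ k) = x $ j * b $ i))"
    using redundant_equivalence by blast
  \<comment> \<open>The two families are compared only through their SDP relaxations, whose feasible
    sets coincide.\<close>
  have sdp: "sdp_value P (redundant_I A b) = sdp_value P (redundant_II A b)"
    if "lin_mat P = A" "lin_rhs P = b" for P :: "('n, 'p, 'q) qprog"
    using sdp_feasible_redundant_eq[of P] that by (simp add: sdp_value_def)
  show "\<forall>P :: ('n, 'p, 'q) qprog.
            symmetric_data P \<and> zero_one P \<and> lin_mat P = A \<and> lin_rhs P = b \<longrightarrow>
              total_lagrangian_value P (redundant_I A b)
                = total_lagrangian_value P (redundant_II A b) \<and>
              total_lagrangian_value P (redundant_II A b)
                = partial_lagrangian_value P (redundant_I A b) \<and>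
              partial_lagrangian_value P (redundant_I A b)
                = partial_lagrangian_value P (redundant_II A b) \<and>
              partial_lagrangian_value P (redundant_II A b)
                = sdp_value P (redundant_I A b) \<and>
              sdp_value P (redundant_I A b) = sdp_value P (redundant_II A b)"
    using sdp by (auto simp: lagrangian_values_eq_sdp)
qed

end
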